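(* Let $n\ge 3$ and let $R$ be a $p_2$-orientation of $P_n$. Then: (i) the multiplier of $v_1$ is $1$; (ii) if $e_2$ is flat, the multiplier of $v_2$ is $1$; if $e_2$ is directed, the multiplier of $v_2$ is $2$; (iii) if $e_{n-2}$ is flat, the multiplier of $v_n$ is $1$; if $e_{n-2}$ is directed, the multiplier of $v_n$ is $2$. Here each statement about a multiplier means: for every admissible choice of $a_1,\dots,a_{k-1}$ (as in the context), the number of admissible values $b$ for $v_k$ equals the stated value.
   Context: Parallel Diffusion on a finite simple graph $G$: a configuration assigns an integer stack size $|v|$ (possibly negative) to each vertex. In one step all vertices fire simultaneously: each vertex sends one chip to each neighbour with strictly smaller stack size. Starting from $C_0$, $C_{t+1}$ is obtained from $C_t$ by one step. A configuration $D$ is a $p_2$-configuration if there are $C_0$ and $N$ such that $C_{t+2}=C_t$ and $C_{t+1}\ne C_t$ for all $t\ge N$, and $D=C_t$ for some $t\ge N$. The path $P_n$ has vertices $v_1,\dots,v_n$ and edges $e_i=v_iv_{i+1}$. A configuration induces the orientation in which each edge is directed from its endpoint with larger stack size to its endpoint with smaller stack size, and is flat if equal; a $p_2$-orientation is one induced by a $p_2$-configuration. Convention: only configurations with $|v_1|=0$ are considered. Multiplier: for a $p_2$-orientation $R$ of $P_n$, an index $1\le k\le n$, and integers $a_1,\dots,a_{k-1}$ that are admissible (there is a $p_2$-configuration $C$ inducing $R$ with $|v_1|^C=0$ and $|v_i|^C=a_i$ for all $i<k$), the multiplier of $v_k$ is the number of integers $b$ for which there is a $p_2$-configuration $C$ inducing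 $R$ with $|v_1|^C=0$, $|v_i|^C=a_i$ for $i<k$, and $|v_k|^C=b$. *)

theory Defs
  imports "Graph_Theory.Pair_Digraph"
begin

(* A finite simple graph is a pair_graph: an undirected edge uv is the pair of opposite arcs
   (u, v), (v, u).  A configuration is a total function; only its values on the vertices matter.
   One step never changes a value off the vertex set, so for the trajectories below equality of
   functions is equality of configurations on the vertices. *)

type_synonym 'a config = "'a \<Rightarrow> int"

definition diffuse :: "'a pair_pre_digraph \<Rightarrow> 'a config \<Rightarrow> 'a config" where
  "diffuse G C v =
     C v - int (card {u. (v, u) \<in> parcs G \<and> C u < C v})
         + int (card {u. (u, v) \<in> parcs G \<and> C v < C u})"

definition p2_config :: "'a pair_pre_digraph \<Rightarrow> 'a config \<Rightarrow> bool" where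
  "p2_config G D \<longleftrightarrow>
     (\<exists>(C :: nat \<Rightarrow> 'a config) N.
        (\<forall>t. C (Suc t) = diffuse G (C t)) \<and>
        (\<forall>t\<ge>N. C (t + 2) = C t \<and> C (t + 1) \<noteq> C t) \<and>
        (\<exists>t\<ge>N. D = C t))"

(* An orientation is represented by the set of its directed edges, from tail to head;
   an edge uv is flat if it contains neither (u, v) nor (v, u). *)

definition induced_orientation :: "'a pair_pre_digraph \<Rightarrow> 'a config \<Rightarrow> 'a rel" where
  "induced_orientation G C = {(u, v) \<in> parcs G. C v < C u}"

definition p2_orientation :: "'a pair_pre_digraph \<Rightarrow> 'a rel \<Rightarrow> bool" where
  "p2_orientation G R \<longleftrightarrow> (\<exists>D. p2_config G D \<and> induced_orientation G D = R)"

(* The vertex v_i is the number i, and the edge e_i joins i and i + 1. *)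

definition path_graph :: "nat \<Rightarrow> nat pair_pre_digraph" where
  "path_graph n =
     \<lparr> pverts = {1..n},
       parcs = {(i, j). i \<in> {1..n} \<and> j \<in> {1..n} \<and> (j = i + 1 \<or> i = j + 1)} \<rparr>"

lemma pair_graph_path_graph: "pair_graph (path_graph n)"
proof -
  have "parcs (path_graph n) \<subseteq> {1..n} \<times> {1..n}"
    by (auto simp: path_graph_def)
  then have "finite (parcs (path_graph n))"
    by (rule finite_subset) simp
  then show ?thesis
    by unfold_locales (auto simp: path_graph_def symmetric_def sym_def)
qed

definition edge_directed :: "nat rel \<Rightarrow> nat \<Rightarrow> bool" where
  "edge_directed R i \<longleftrightarrow> (i, i + 1) \<in> R \<or> (i + 1, i) \<in> R"

definition edge_flat :: "nat rel \<Rightarrow> nat \<Rightarrow> bool" where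
  "edge_flat R i \<longleftrightarrow> \<not> edge_directed R i"

(* Only the values a 1, ..., a (k - 1) of the function a are used. *)

definition realizes :: "nat \<Rightarrow> nat rel \<Rightarrow> nat \<Rightarrow> (nat \<Rightarrow> int) \<Rightarrow> nat config \<Rightarrow> bool" where
  "realizes n R k a C \<longleftrightarrow>
     p2_config (path_graph n) C \<and> induced_orientation (path_graph n) C = R \<and>
     C 1 = 0 \<and> (\<forall>i\<in>{1..<k}. C i = a i)"

definition admissible :: "nat \<Rightarrow> nat rel \<Rightarrow> nat \<Rightarrow> (nat \<Rightarrow> int) \<Rightarrow> bool" where
  "admissible n R k a \<longleftrightarrow> (\<exists>C. realizes n R k a C)"

definition multiplier :: "nat \<Rightarrow> nat rel \<Rightarrow> nat \<Rightarrow> (nat \<Rightarrow> int) \<Rightarrow> nat" where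
  "multiplier n R k a = card {b. \<exists>C. realizes n R k a C \<and> C k = b}"

end

theory Submission
  imports Defs
begin

text \<open>
  Let \<open>s i\<close> be the flow from \<open>v\<^sub>i\<close> to \<open>v\<^sub>i\<^sub>+\<^sub>1\<close>, the sign of the drop
  \<open>d i = |v\<^sub>i| - |v\<^sub>i\<^sub>+\<^sub>1|\<close>. A configuration has period 2 exactly when the next step reverses every
  flow and some flow is nonzero. After one step the drop is
  \<open>d i - 2 * s i + s (i - 1) + s (i + 1)\<close>, so for a fixed orientation the period condition
  constrains every drop separately, to an interval of \<open>1 - s i * (s (i - 1) + s (i + 1))\<close> integers.
  This number is the multiplier of \<open>v\<^sub>i\<^sub>+\<^sub>1\<close>. At both ends of the path one of the neighbouring
  flows is 0.
\<close>

text \<open>Diffusion is deterministic, so one return after two steps already makes the whole orbit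
  alternate, and \<open>N = 0\<close> serves as the starting time.\<close>

lemma p2_config_iff: "p2_config G D \<longleftrightarrow> diffuse G (diffuse G D) = D \<and> diffuse G D \<noteq> D"
proof
  assume "p2_config G D"
  then obtain C N t where C: "\<And>t. C (Suc t) = diffuse G (C t)"
    and N: "\<And>t. t \<ge> N \<Longrightarrow> C (t + 2) = C t \<and> C (t + 1) \<noteq> C t" and t: "t \<ge> N" "D = C t"
    unfolding p2_config_def by blast
  from N[OF t(1)] show "diffuse G (diffuse G D) = D \<and> diffuse G D \<noteq> D"
    by (simp add: t(2) C)
next
  assume D: "diffuse G (diffuse G D) = D \<and> diffuse G D \<noteq> D"
  define C where "C t = (if even t then D else diffuse G D)" for t :: nat
  have "C (Suc t) = diffuse G (C t)" "C (t + 2) = C t" "C (t + 1) \<noteq> C t" for t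
    using D by (auto simp: C_def)
  moreover have "D = C 0"
    by (simp add: C_def)
  ultimately show "p2_config G D"
    unfolding p2_config_def by blast
qed

text \<open>The value 0 off the edges stands for the missing neighbours, so that the end vertices
  obey the same formulas as the inner ones.\<close>

definition flow :: "nat \<Rightarrow> nat config \<Rightarrow> nat \<Rightarrow> int" where
  "flow n C i = (if 1 \<le> i \<and> i < n then sgn (C i - C (Suc i)) else 0)"

lemma flow_0 [simp]: "flow n C 0 = 0"
  and flow_ge [simp]: "n \<le> i \<Longrightarrow> flow n C i = 0"
  by (simp_all add: flow_def)

lemma flow_cases: "flow n C i = -1 \<or> flow n C i = 0 \<or> flow n C i = 1"
  by (auto simp: flow_def sgn_if)

lemma diffuse_path_graph_0: "diffuse (path_graph n) C 0 = C 0"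
  by (simp add: diffuse_def path_graph_def)

lemma diffuse_path_graph_Suc:
  "diffuse (path_graph n) C (Suc i) = C (Suc i) - flow n C (Suc i) + flow n C i"
proof -
  \<comment> \<open>Each set is split into its right and left neighbour, so that its cardinality
    follows by cases on the two flows.\<close>
  have "{u. (Suc i, u) \<in> parcs (path_graph n) \<and> C u < C (Suc i)} =
      (if Suc i < n \<and> C (Suc (Suc i)) < C (Suc i) then {Suc (Suc i)} else {}) \<union>
      (if 1 \<le> i \<and> i < n \<and> C i < C (Suc i) then {i} else {})"
    "{u. (u, Suc i) \<in> parcs (path_graph n) \<and> C (Suc i) < C u} =
      (if Suc i < n \<and> C (Suc i) < C (Suc (Suc i)) then {Suc (Suc i)} else {}) \<union>
      (if 1 \<le> i \<and> i < n \<and> C (Suc i) < C i then {i} else {})"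
    by (auto simp: path_graph_def)
  then show ?thesis
    unfolding diffuse_def by (auto simp: flow_def sgn_if)
qed

text \<open>This allows a fixed orientation to be treated as a fixed sequence of signs.\<close>

lemma induced_orientation_eq_iff_flow:
  "induced_orientation (path_graph n) C = induced_orientation (path_graph n) D \<longleftrightarrow>
    flow n C = flow n D"
proof
  assume eq: "induced_orientation (path_graph n) C = induced_orientation (path_graph n) D"
  show "flow n C = flow n D"
  proof
    fix i
    have "(C (Suc i) < C i \<longleftrightarrow> D (Suc i) < D i) \<and> (C i < C (Suc i) \<longleftrightarrow> D i < D (Suc i))"
      if "1 \<le> i" "i < n"
    proof -
      from that have "(i, Suc i) \<in> parcs (path_graph n)" "(Suc i, i) \<in> parcs (path_graph n)"
        by (auto simp: path_graph_def)
      then show ?thesis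
        using eq unfolding induced_orientation_def by blast
    qed
    then show "flow n C i = flow n D i"
      by (auto simp: flow_def sgn_if)
  qed
next
  assume "flow n C = flow n D"
  then have "sgn (C i - C (Suc i)) = sgn (D i - D (Suc i))" if "1 \<le> i" "i < n" for i
    using that by (auto simp: flow_def fun_eq_iff split: if_splits)
  then have "C (Suc i) < C i \<longleftrightarrow> D (Suc i) < D i" "C i < C (Suc i) \<longleftrightarrow> D i < D (Suc i)"
    if "1 \<le> i" "i < n" for i
    using that by (smt (verit) sgn_if)+
  then show "induced_orientation (path_graph n) C = induced_orientation (path_graph n) D"
    by (auto simp: induced_orientation_def path_graph_def)
qed

lemma edge_directed_iff_flow:
  assumes "1 \<le> i" "i < n"
  shows "edge_directed (induced_orientation (path_graph n) C) i \<longleftrightarrow> flow n C i \<noteq> 0"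
  using assms
  by (auto simp: edge_directed_def induced_orientation_def path_graph_def flow_def sgn_if)

text \<open>Over two steps each vertex loses the total flow on its right edge and gains the one on
  its left edge. If every stack returns, this total is the same on all edges, and it is 0 at index
  0, which starts the induction. The same argument with a single step shows that a fixed
  configuration has no flow.\<close>

lemma p2_config_path_graph_flow:
  "p2_config (path_graph n) C \<longleftrightarrow>
    (\<forall>i. flow n (diffuse (path_graph n) C) i = - flow n C i) \<and> (\<exists>i. flow n C i \<noteq> 0)"
proof -
  have eqI: "f = g" if "f 0 = g 0" "\<And>i. f (Suc i) = g (Suc i)" for f g :: "nat \<Rightarrow> int"
    using that by (metis ext not0_implies_Suc)
  let ?C = "diffuse (path_graph n) C"
  have "diffuse (path_graph n) ?C = C \<longleftrightarrow> (\<forall>i. flow n ?C i = - flow n C i)"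
  proof
    assume eq: "diffuse (path_graph n) ?C = C"
    show "\<forall>i. flow n ?C i = - flow n C i"
    proof
      fix i
      show "flow n ?C i = - flow n C i"
      proof (induction i)
        case (Suc i)
        have "diffuse (path_graph n) ?C (Suc i) = C (Suc i)"
          by (simp add: eq)
        with Suc show ?case
          by (simp add: diffuse_path_graph_Suc)
      qed simp
    qed
  next
    assume "\<forall>i. flow n ?C i = - flow n C i"
    then show "diffuse (path_graph n) ?C = C"
      by (intro eqI) (simp_all add: diffuse_path_graph_0 diffuse_path_graph_Suc)
  qed
  moreover have "?C = C \<longleftrightarrow> (\<forall>i. flow n C i = 0)"
  proof
    assume eq: "?C = C"
    show "\<forall>i. flow n C i = 0"
    proof
      fix i
      show "flow n C i = 0"
      proof (induction i)
        case (Suc i)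
        have "?C (Suc i) = C (Suc i)"
          by (simp add: eq)
        with Suc show ?case
          by (simp add: diffuse_path_graph_Suc)
      qed simp
    qed
  next
    assume "\<forall>i. flow n C i = 0"
    then show "?C = C"
      by (intro eqI) (simp_all add: diffuse_path_graph_0 diffuse_path_graph_Suc)
  qed
  ultimately show ?thesis
    by (simp add: p2_config_iff)
qed

text \<open>Here \<open>l\<close>, \<open>s\<close>, \<open>r\<close> are the flows along three
  consecutive edges and \<open>d\<close> is the drop along the middle one. With the flows as
  parameters, a fixed orientation leaves a condition on \<open>d\<close> alone.\<close>

definition drop_reversed :: "int \<Rightarrow> int \<Rightarrow> int \<Rightarrow> int \<Rightarrow> bool" where
  "drop_reversed l s r d \<longleftrightarrow> sgn d = s \<and> sgn (d - 2 * s + l + r) = - s"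

lemma p2_config_path_graph_iff:
  "p2_config (path_graph n) C \<longleftrightarrow>
    (\<forall>i. Suc i < n \<longrightarrow> drop_reversed (flow n C i) (flow n C (Suc i)) (flow n C (Suc (Suc i)))
      (C (Suc i) - C (Suc (Suc i)))) \<and> (\<exists>i. flow n C i \<noteq> 0)"
proof -
  \<comment> \<open>Off the edges both flows are 0, so only genuine edges remain to be
    checked.\<close>
  have "(\<forall>i. flow n (diffuse (path_graph n) C) i = - flow n C i) \<longleftrightarrow>
    (\<forall>i. Suc i < n \<longrightarrow> flow n (diffuse (path_graph n) C) (Suc i) = - flow n C (Suc i))"
    by (metis add.inverse_neutral flow_0 flow_ge not0_implies_Suc not_le)
  moreover have "flow n (diffuse (path_graph n) C) (Suc i) =
      sgn (C (Suc i) - C (Suc (Suc i)) - 2 * flow n C (Suc i) + flow n C i + flow n C (Suc (Suc i)))"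
    if "Suc i < n" for i
    using that by (simp add: flow_def[of n "diffuse _ _"] diffuse_path_graph_Suc algebra_simps)
  moreover have "sgn (C (Suc i) - C (Suc (Suc i))) = flow n C (Suc i)" if "Suc i < n" for i
    using that by (simp add: flow_def)
  ultimately show ?thesis
    unfolding p2_config_path_graph_flow drop_reversed_def by auto
qed

text \<open>The hypothesis makes \<open>s\<close> a sign and, if \<open>s = 0\<close>, forces
  \<open>l + r = 0\<close>. For \<open>s = 1\<close> the two conditions read
  \<open>d \<ge> 1\<close> and \<open>d - 2 + l + r \<le> -1\<close>; the case \<open>s = -1\<close>
  is the mirror image.\<close>

lemma card_drop_reversed:
  assumes "drop_reversed l s r d"
  shows "card {d. drop_reversed l s r d} = nat (1 - s * (l + r))"
proof -
  consider "s = 0" | "s = 1" | "s = -1"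
    using assms by (cases d "0 :: int" rule: linorder_cases) (auto simp: drop_reversed_def)
  then show ?thesis
  proof cases
    case 1
    with assms have "{d. drop_reversed l s r d} = {0}"
      by (auto simp: drop_reversed_def sgn_if split: if_splits)
    with 1 show ?thesis by simp
  next
    case 2
    then have "{d. drop_reversed l s r d} = {1..1 - l - r}"
      by (auto simp: drop_reversed_def sgn_if split: if_splits)
    with 2 show ?thesis by (simp add: algebra_simps)
  next
    case 3
    then have "{d. drop_reversed l s r d} = {-1 - l - r..-1}"
      by (auto simp: drop_reversed_def sgn_if split: if_splits)
    with 3 show ?thesis by (simp add: algebra_simps)
  qed
qed

lemma multiplier_path_graph:
  assumes D: "realizes n R (Suc (Suc i)) a D" and i: "Suc i < n"
  shows "multiplier n R (Suc (Suc i)) a =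
    nat (1 - flow n D (Suc i) * (flow n D i + flow n D (Suc (Suc i))))"
proof -
  let ?P = "drop_reversed (flow n D i) (flow n D (Suc i)) (flow n D (Suc (Suc i)))"
  have p2: "p2_config (path_graph n) D" and R: "R = induced_orientation (path_graph n) D"
    and D1: "D 1 = 0" and Da: "\<And>j. j \<in> {1..<Suc (Suc i)} \<Longrightarrow> D j = a j"
    using D by (auto simp: realizes_def)
  have "(\<exists>C. realizes n R (Suc (Suc i)) a C \<and> C (Suc (Suc i)) = b) \<longleftrightarrow> ?P (D (Suc i) - b)" for b
  proof
    assume "\<exists>C. realizes n R (Suc (Suc i)) a C \<and> C (Suc (Suc i)) = b"
    then obtain C where C: "realizes n R (Suc (Suc i)) a C" "C (Suc (Suc i)) = b" by blast
    then have "flow n C = flow n D"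
      by (simp add: realizes_def R induced_orientation_eq_iff_flow)
    moreover have "C (Suc i) = D (Suc i)"
      using C Da[of "Suc i"] by (simp add: realizes_def)
    moreover have "p2_config (path_graph n) C"
      using C by (simp add: realizes_def)
    ultimately show "?P (D (Suc i) - b)"
      using i C(2) by (auto simp: p2_config_path_graph_iff)
  next
    assume b: "?P (D (Suc i) - b)"
    \<comment> \<open>Shifting all stacks beyond \<open>Suc i\<close> by one constant gives the next
      vertex the value \<open>b\<close> and changes no drop other than that at
      \<open>Suc i\<close>.\<close>
    define C where "C j = (if j \<le> Suc i then D j else D j + (b - D (Suc (Suc i))))" for j
    have drop: "C j - C (Suc j) = (if j = Suc i then D (Suc i) - b else D j - D (Suc j))" for j
      by (auto simp: C_def le_Suc_eq)
    \<comment> \<open>The changed drop keeps its sign, since \<open>drop_reversed\<close> prescribes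
      it.\<close>
    have "flow n C j = flow n D j" for j
      using b by (simp add: flow_def[of n C] drop) (auto simp: flow_def drop_reversed_def)
    then have flow: "flow n C = flow n D" by blast
    have "p2_config (path_graph n) C"
      using p2 b unfolding p2_config_path_graph_iff flow by (simp add: drop)
    moreover have "induced_orientation (path_graph n) C = R"
      by (simp add: R induced_orientation_eq_iff_flow flow)
    moreover have "C 1 = 0" "\<forall>j\<in>{1..<Suc (Suc i)}. C j = a j"
      using D1 Da by (auto simp: C_def)
    ultimately have "realizes n R (Suc (Suc i)) a C"
      by (simp add: realizes_def)
    moreover have "C (Suc (Suc i)) = b"
      by (simp add: C_def)
    ultimately show "\<exists>C. realizes n R (Suc (Suc i)) a C \<and> C (Suc (Suc i)) = b" by blast
  qed
  then have "multiplier n R (Suc (Suc i)) a = card {b. ?P (D (Suc i) - b)}"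
    by (simp add: multiplier_def)
  also have "{b. ?P (D (Suc i) - b)} = (\<lambda>d. D (Suc i) - d) ` {d. ?P d}"
    by (auto intro: rev_image_eqI)
  also have "card \<dots> = card {d. ?P d}"
    by (rule card_image) (simp add: inj_on_def)
  also have "\<dots> = nat (1 - flow n D (Suc i) * (flow n D i + flow n D (Suc (Suc i))))"
    using p2 i by (intro card_drop_reversed) (auto simp: p2_config_path_graph_iff)
  finally show ?thesis .
qed

text \<open>The drop of a flat edge must stay 0, so the neighbouring flows cancel. On a directed
  edge the drop is at least 1 in absolute value, and the edge's own flow lowers it by only 2;
  neighbours pushing the other way would keep it from changing sign.\<close>

lemma p2_flow_neighbours:
  assumes "p2_config (path_graph n) C" "Suc i < n"
  shows "flow n C (Suc i) = 0 \<Longrightarrow> flow n C i + flow n C (Suc (Suc i)) = 0"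
    and "flow n C (Suc i) * (flow n C i + flow n C (Suc (Suc i))) \<le> 0"
proof -
  have "drop_reversed (flow n C i) (flow n C (Suc i)) (flow n C (Suc (Suc i)))
      (C (Suc i) - C (Suc (Suc i)))"
    using assms by (auto simp: p2_config_path_graph_iff)
  then show "flow n C (Suc i) = 0 \<Longrightarrow> flow n C i + flow n C (Suc (Suc i)) = 0"
    "flow n C (Suc i) * (flow n C i + flow n C (Suc (Suc i))) \<le> 0"
    by (auto simp: drop_reversed_def sgn_if split: if_splits)
qed

text \<open>At an end of the path only the neighbouring flow at \<open>j\<close> survives. If it is
  nonzero, the end edge cannot be flat and must carry the opposite flow, so the product is -1 and
  the count is 2.\<close>

lemma multiplier_end_edge:
  assumes "realizes n R (Suc (Suc i)) a D" "Suc i < n"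
    and nb: "1 \<le> j" "j < n" "flow n D i + flow n D (Suc (Suc i)) = flow n D j"
  shows "multiplier n R (Suc (Suc i)) a = (if edge_directed R j then 2 else 1)"
proof -
  have p2: "p2_config (path_graph n) D" and R: "R = induced_orientation (path_graph n) D"
    using assms(1) by (auto simp: realizes_def)
  have "flow n D (Suc i) * flow n D j = (if flow n D j = 0 then 0 else -1)"
    using p2_flow_neighbours[OF p2 assms(2)] flow_cases[of n D "Suc i"] flow_cases[of n D j]
    unfolding nb(3) by auto
  moreover have "edge_directed R j \<longleftrightarrow> flow n D j \<noteq> 0"
    unfolding R using nb by (intro edge_directed_iff_flow)
  ultimately show ?thesis
    using multiplier_path_graph[OF assms(1,2)] unfolding nb(3) by simp
qed

theorem theorem4:
  fixes n :: nat and R :: "nat rel"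
  assumes "3 \<le> n"
    and "p2_orientation (path_graph n) R"
  shows "(\<forall>a. admissible n R 1 a \<longrightarrow> multiplier n R 1 a = 1) \<and>
    (edge_flat R 2 \<longrightarrow> (\<forall>a. admissible n R 2 a \<longrightarrow> multiplier n R 2 a = 1)) \<and>
    (edge_directed R 2 \<longrightarrow> (\<forall>a. admissible n R 2 a \<longrightarrow> multiplier n R 2 a = 2)) \<and>
    (edge_flat R (n - 2) \<longrightarrow> (\<forall>a. admissible n R n a \<longrightarrow> multiplier n R n a = 1)) \<and>
    (edge_directed R (n - 2) \<longrightarrow> (\<forall>a. admissible n R n a \<longrightarrow> multiplier n R n a = 2))"
proof -
  have first: "multiplier n R 1 a = 1" if "admissible n R 1 a" for a
  proof -
    have "{b. \<exists>C. realizes n R 1 a C \<and> C 1 = b} = {0}"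
      using that by (auto simp: admissible_def realizes_def)
    then show ?thesis
      by (simp add: multiplier_def)
  qed
  have second: "multiplier n R 2 a = (if edge_directed R 2 then 2 else 1)"
    if adm: "admissible n R 2 a" for a
  proof -
    obtain D where "realizes n R (Suc (Suc 0)) a D"
      using adm unfolding admissible_def numeral_2_eq_2 by blast
    \<comment> \<open>The end edge is the first one: the flow at 0 vanishes and \<open>j = 2\<close>
      remains.\<close>
    from multiplier_end_edge[OF this, of 2] show ?thesis
      using assms(1) by (simp add: numeral_2_eq_2)
  qed
  have last: "multiplier n R n a = (if edge_directed R (n - 2) then 2 else 1)"
    if adm: "admissible n R n a" for a
  proof -
    from assms(1) have n: "Suc (Suc (n - 2)) = n" by simp
    obtain D where "realizes n R (Suc (Suc (n - 2))) a D"
      using adm by (auto simp: admissible_def n)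
    \<comment> \<open>The end edge is the one at \<open>n - 1\<close>: the flow at \<open>n\<close>
      vanishes and \<open>j = n - 2\<close> remains, which is at least 1 because
      \<open>n \<ge> 3\<close>.\<close>
    from multiplier_end_edge[OF this, of "n - 2"] show ?thesis
      using assms(1) by (simp add: n)
  qed
  show ?thesis
    using first second last by (auto simp: edge_flat_def)
qed

end
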